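(* Let $w_1,w_2,w_3$ be any odd positive integers, let $y_1\in\mathbb{Z}_p$, and let $n\ge 0$ be an integer. Then \begin{align*} &\sum_{k+l+m=n}\binom{n}{k,l,m}E_{k,\chi,\xi^{w_2w_3}}(w_1y_1)T_l(w_2d-1;\chi,\xi^{w_1w_3})T_m(w_3d-1;\chi,\xi^{w_1w_2})\,w_{1}^{l+m}w_{2}^{k+m}w_{3}^{k+l}\\ =&\sum_{k+l+m=n}\binom{n}{k,l,m}E_{k,\chi,\xi^{w_1w_3}}(w_2y_1)T_l(w_3d-1;\chi,\xi^{w_1w_2})T_m(w_1d-1;\chi,\xi^{w_2w_3})\,w_{2}^{l+m}w_{3}^{k+m}w_{1}^{k+l}\\ =&\sum_{k+l+m=n}\binom{n}{k,l,m}E_{k,\chi,\xi^{w_1w_2}}(w_3y_1)T_l(w_1d-1;\chi,\xi^{w_2w_3})T_m(w_2d-1;\chi,\xi^{w_1w_3})\,w_{3}^{l+m}w_{1}^{k+m}w_{2}^{k+l}. \end{align*}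
   Context: Let $p$ be a fixed odd prime, $\mathbb{Z}_p$ the $p$-adic integers, $\mathbb{C}_p$ the completion of an algebraic closure of $\mathbb{Q}_p$. Let $\xi\in\mathbb{C}_p$ be a fixed ramified root of unity, i.e. $\xi^{p^s}=1$ for some positive integer $s$. Let $d$ be a fixed odd positive integer and $\chi$ a primitive Dirichlet character of conductor $d$, regarded as a function on the integers (periodic mod $d$, zero on integers not coprime to $d$) with values in $\mathbb{C}_p$ via a fixed embedding $\overline{\mathbb{Q}}\to\mathbb{C}_p$. For a ramified root of unity $\zeta$ (e.g. $\zeta=\xi^{w}$), the generalized twisted Euler polynomials $E_{n,\chi,\zeta}(x)$ are the polynomials in $x$ defined by $$\frac{2e^{xt}}{\zeta^d e^{dt}+1}\sum_{a=0}^{d-1}(-1)^a\chi(a)\zeta^a e^{at}=\sum_{n=0}^{\infty}E_{n,\chi,\zeta}(x)\frac{t^n}{n!}.$$ The alternating generalized twisted power sum is $T_k(N;\chi,\zeta)=\sum_{a=0}^{N}(-1)^a\chi(a)\zeta^a a^k$ (with $0^0=1$). The sums are over nonnegative integers $k,l,m$ with $k+l+m=n$, and $\binom{n}{k,l,m}=\frac{n!}{k!\,l!\,m!}$. *)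

theory Defs
  imports "HOL-Analysis.Elementary_Topology" "HOL-Computational_Algebra.Computational_Algebra"
begin

definition padic_abs :: "nat \<Rightarrow> rat \<Rightarrow> real" where
  "padic_abs p r = (if r = 0 then 0 else
     (let (a, b) = quotient_of r
      in real p powi (int (multiplicity (int p) b) - int (multiplicity (int p) a))))"

definition algebraic_over :: "'a::field set \<Rightarrow> 'a \<Rightarrow> bool" where
  "algebraic_over S x \<longleftrightarrow> (\<exists>q. q \<noteq> 0 \<and> (\<forall>i. coeff q i \<in> S) \<and> poly q x = 0)"

definition alg_closed_set :: "'a::field set \<Rightarrow> bool" where
  "alg_closed_set S \<longleftrightarrow>
     (\<forall>q. degree q > 0 \<and> (\<forall>i. coeff q i \<in> S) \<longrightarrow> (\<exists>x\<in>S. poly q x = 0))"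

text \<open>
  A type cannot depend on the prime \<open>p\<close>, so the field of \<open>p\<close>-adic complex numbers is given by the
  property that determines it up to isometric isomorphism. It is a complete field whose metric
  comes from a multiplicative absolute value \<open>dist x 0\<close> extending the \<open>p\<close>-adic one on the
  rationals. In it, the closure of the rationals is a completion of \<open>\<rat>\<close>, i.e. the field of
  \<open>p\<close>-adic numbers; the elements algebraic over that field form an algebraic closure of it, and
  this algebraic closure is dense. Completeness is the type class \<open>complete_space\<close>.
\<close>

definition Qp :: "'a::{field_char_0, complete_space} set" where
  "Qp = closure \<rat>"

definition Qp_bar :: "'a::{field_char_0, complete_space} set" where
  "Qp_bar = {x. algebraic_over Qp x}"

definition Zp :: "'a::{field_char_0, complete_space} set" where
  "Zp = {x \<in> Qp. dist x 0 \<le> 1}"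

definition is_Cp :: "nat \<Rightarrow> 'a::{field_char_0, complete_space} itself \<Rightarrow> bool" where
  "is_Cp p T \<longleftrightarrow>
     (\<forall>x y :: 'a. dist x y = dist (x - y) 0) \<and>
     (\<forall>x y :: 'a. dist (x * y) 0 = dist x 0 * dist y 0) \<and>
     (\<forall>x y :: 'a. dist (x + y) 0 \<le> max (dist x 0) (dist y 0)) \<and>
     (\<forall>r :: rat. dist (of_rat r :: 'a) 0 = padic_abs p r) \<and>
     alg_closed_set (Qp_bar :: 'a set) \<and>
     closure (Qp_bar :: 'a set) = UNIV"

definition dirichlet_character :: "nat \<Rightarrow> (int \<Rightarrow> complex) \<Rightarrow> bool" where
  "dirichlet_character d chi \<longleftrightarrow> d > 0 \<and>
     (\<forall>a b. chi (a * b) = chi a * chi b) \<and>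
     (\<forall>a. chi (a + int d) = chi a) \<and>
     (\<forall>a. chi a = 0 \<longleftrightarrow> \<not> coprime a (int d))"

definition conductor :: "nat \<Rightarrow> (int \<Rightarrow> complex) \<Rightarrow> nat" where
  "conductor d chi = (LEAST e. e dvd d \<and>
     (\<exists>\<psi>. dirichlet_character e \<psi> \<and> (\<forall>a. coprime a (int d) \<longrightarrow> chi a = \<psi> a)))"

definition primitive_character :: "nat \<Rightarrow> (int \<Rightarrow> complex) \<Rightarrow> bool" where
  "primitive_character d chi \<longleftrightarrow> dirichlet_character d chi \<and> conductor d chi = d"

text \<open>Only the values of \<open>\<sigma>\<close> at algebraic numbers are constrained.\<close>

definition embedding_of_algebraic_numbers :: "(complex \<Rightarrow> 'a::field) \<Rightarrow> bool" where
  "embedding_of_algebraic_numbers \<sigma> \<longleftrightarrow>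
     \<sigma> 1 = 1 \<and> inj_on \<sigma> {x. algebraic x} \<and>
     (\<forall>x y. algebraic x \<and> algebraic y \<longrightarrow> \<sigma> (x + y) = \<sigma> x + \<sigma> y \<and> \<sigma> (x * y) = \<sigma> x * \<sigma> y)"

definition twisted_euler_gf :: "nat \<Rightarrow> (int \<Rightarrow> 'a::field_char_0) \<Rightarrow> 'a \<Rightarrow> 'a fps" where
  "twisted_euler_gf d chi \<zeta> =
     2 / (fps_const (\<zeta> ^ d) * fps_exp (of_nat d) + 1) *
     (\<Sum>a = 0..d - 1. fps_const ((-1) ^ a * chi (int a) * \<zeta> ^ a) * fps_exp (of_nat a))"

text \<open>
  The generating function lives in \<open>K[x][[t]]\<close>: the first factor below is \<open>exp (x t)\<close>, and the
  second is the \<open>x\<close>-free part of the generating function, with its coefficients in \<open>K\<close> read as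
  constant polynomials.
\<close>

definition twisted_euler_poly ::
    "nat \<Rightarrow> nat \<Rightarrow> (int \<Rightarrow> 'a::field_char_0) \<Rightarrow> 'a \<Rightarrow> 'a poly" where
  "twisted_euler_poly d n chi \<zeta> = smult (fact n)
     (fps_nth (Abs_fps (\<lambda>i. monom (1 / fact i) i) *
               Abs_fps (\<lambda>i. [:fps_nth (twisted_euler_gf d chi \<zeta>) i:])) n)"

definition alt_power_sum :: "nat \<Rightarrow> nat \<Rightarrow> (int \<Rightarrow> 'a::field_char_0) \<Rightarrow> 'a \<Rightarrow> 'a" where
  "alt_power_sum k N chi \<zeta> = (\<Sum>a = 0..N. (-1) ^ a * chi (int a) * \<zeta> ^ a * of_nat a ^ k)"

lemma twisted_euler_poly_generating_function:
  "Abs_fps (\<lambda>n. poly (twisted_euler_poly d n chi \<zeta>) x / fact n) =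
     fps_exp x * twisted_euler_gf d chi \<zeta>"
  by (rule fps_ext)
     (simp add: twisted_euler_poly_def fps_mult_nth poly_sum poly_monom mult.commute)

definition trinomial :: "nat \<Rightarrow> nat \<Rightarrow> nat \<Rightarrow> nat \<Rightarrow> 'a::field_char_0" where
  "trinomial n k l m = fact n / (fact k * fact l * fact m)"

end

theory Submission
  imports Defs
begin

text \<open>
  Write \<open>w = w\<^sub>1w\<^sub>2w\<^sub>3\<close>, \<open>c\<^sub>i = w/w\<^sub>i\<close>, \<open>\<zeta>\<^sub>i = \<xi>^c\<^sub>i\<close>, \<open>D\<^sub>i = \<zeta>\<^sub>i^d exp (d c\<^sub>i t) + 1\<close> and
  \<open>S\<^sub>i = \<Sum>a<d. (-1)^a \<chi>(a) \<zeta>\<^sub>i^a exp (a c\<^sub>i t)\<close>. Since \<open>d\<close> and \<open>w\<^sub>i\<close> are odd, a geometric sum shows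
  that the exponential generating function of the scaled power sums \<open>T\<^sub>l(w\<^sub>id - 1)\<close> is
  \<open>S\<^sub>i (1 + A) / D\<^sub>i\<close> with \<open>A = \<xi>^(dw) exp (d w t)\<close> independent of \<open>i\<close>. So the three sums have the
  common generating function \<open>2 exp (w y t) S\<^sub>1S\<^sub>2S\<^sub>3 (1 + A)\<^sup>2 / (D\<^sub>1D\<^sub>2D\<^sub>3)\<close>. That \<open>\<xi>\<close> has odd order
  guarantees \<open>\<zeta>\<^sub>i^d \<noteq> -1\<close>, which makes \<open>D\<^sub>i\<close> invertible.
\<close>

text \<open>The scale \<open>c\<close> stands for the substitution of \<open>c t\<close> for
  \<open>t\<close>. Length \<open>N = d\<close> gives the sums \<open>S\<^sub>i\<close>, length
  \<open>N = w\<^sub>i d\<close> the power sums.\<close>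

definition alt_exp_sum :: "nat \<Rightarrow> (int \<Rightarrow> 'a::field_char_0) \<Rightarrow> 'a \<Rightarrow> 'a \<Rightarrow> 'a fps" where
  "alt_exp_sum N chi \<zeta> c =
     (\<Sum>a<N. fps_const ((-1) ^ a * chi (int a) * \<zeta> ^ a) * fps_exp (of_nat a * c))"

lemma alt_power_sum_egf:
  assumes "N > 0"
  shows "Abs_fps (\<lambda>l. c ^ l * alt_power_sum l (N - 1) chi \<zeta> / fact l) = alt_exp_sum N chi \<zeta> c"
proof (rule fps_ext)
  fix l
  \<comment> \<open>Natural subtraction makes \<open>N - 1\<close> equal to \<open>0\<close> at
    \<open>N = 0\<close>, where the left range would keep the index \<open>0\<close>; hence
    \<open>N > 0\<close>.\<close>
  have "{0..N - 1} = {..<N}" using assms by auto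
  then show "Abs_fps (\<lambda>l. c ^ l * alt_power_sum l (N - 1) chi \<zeta> / fact l) $ l =
      alt_exp_sum N chi \<zeta> c $ l"
    by (simp add: alt_power_sum_def alt_exp_sum_def fps_sum_nth sum_distrib_left
        sum_divide_distrib power_mult_distrib mult_ac)
qed

lemma periodic_shift:
  fixes chi :: "int \<Rightarrow> 'a"
  assumes "\<And>a. chi (a + int d) = chi a"
  shows "chi (a + int (w * d)) = chi a"
proof (induction w)
  case (Suc w)
  then show ?case using assms[of "a + int (w * d)"] by (simp add: algebra_simps)
qed simp

lemma sum_lessThan_add:
  fixes f :: "nat \<Rightarrow> 'a::comm_monoid_add"
  shows "(\<Sum>a<m + n. f a) = (\<Sum>a<m. f a) + (\<Sum>a<n. f (m + a))"
  by (induction n) (simp_all add: add.assoc)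

text \<open>Cut the range into \<open>w\<close> blocks of length \<open>d\<close>. By periodicity
  the block starting at \<open>j * d\<close> is \<open>(- q) ^ j\<close> times the first one, so the
  sum is geometric with ratio \<open>- q\<close>, and multiplying by \<open>q + 1\<close> telescopes
  it.\<close>

lemma alt_exp_sum_mult:
  fixes chi :: "int \<Rightarrow> 'a::field_char_0" and \<zeta> c :: 'a
  assumes per: "\<And>a. chi (a + int d) = chi a" and "odd d"
  defines "q \<equiv> fps_const (\<zeta> ^ d) * fps_exp (of_nat d * c)"
  shows "(q + 1) * alt_exp_sum (w * d) chi \<zeta> c = alt_exp_sum d chi \<zeta> c * (1 - (- q) ^ w)"
proof (induction w)
  case (Suc w)
  \<comment> \<open>As \<open>d\<close> is odd, a shift by \<open>d\<close> flips the sign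
    \<open>(-1) ^ a\<close>; this is why the ratio is \<open>- q\<close> and not
    \<open>q\<close>.\<close>
  have qw: "(- q) ^ w = fps_const ((-1) ^ (w * d) * \<zeta> ^ (w * d)) * fps_exp (of_nat (w * d) * c)"
  proof -
    have "(-1 :: 'a) ^ (w * d) = (-1) ^ w"
      using \<open>odd d\<close> by (simp add: minus_one_power_iff)
    moreover have "(- q) ^ w = fps_const ((-1) ^ w) * q ^ w"
      by (subst power_minus) (metis fps_const_1_eq_1 fps_const_neg fps_const_power)
    ultimately show ?thesis
      by (simp add: q_def power_mult_distrib fps_const_power fps_exp_power_mult
          flip: power_mult fps_const_mult) (simp add: mult_ac)
  qed
  have "alt_exp_sum (Suc w * d) chi \<zeta> c = alt_exp_sum (w * d) chi \<zeta> c +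
    (\<Sum>a<d. fps_const ((-1) ^ (w * d + a) * chi (int (w * d + a)) * \<zeta> ^ (w * d + a)) *
       fps_exp (of_nat (w * d + a) * c))"
    unfolding alt_exp_sum_def by (simp only: mult_Suc add.commute[of d] sum_lessThan_add)
  also have "(\<Sum>a<d. fps_const ((-1) ^ (w * d + a) * chi (int (w * d + a)) * \<zeta> ^ (w * d + a)) *
       fps_exp (of_nat (w * d + a) * c)) = (- q) ^ w * alt_exp_sum d chi \<zeta> c"
    unfolding alt_exp_sum_def qw sum_distrib_left
  proof (rule sum.cong[OF refl])
    fix a
    have "chi (int (w * d + a)) = chi (int a)"
      using periodic_shift[of chi, OF per, of "int a" w] by (simp add: add.commute)
    then show "fps_const ((-1) ^ (w * d + a) * chi (int (w * d + a)) * \<zeta> ^ (w * d + a)) *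
        fps_exp (of_nat (w * d + a) * c) =
      fps_const ((-1) ^ (w * d) * \<zeta> ^ (w * d)) * fps_exp (of_nat (w * d) * c) *
        (fps_const ((-1) ^ a * chi (int a) * \<zeta> ^ a) * fps_exp (of_nat a * c))"
      by (simp only: power_add of_nat_add distrib_right distrib_left fps_exp_add_mult fps_const_mult[symmetric]
          mult_ac)
  qed
  finally show ?case
    using Suc by (simp add: algebra_simps)
qed (simp add: alt_exp_sum_def)

text \<open>For odd \<open>w\<close> the factor \<open>1 - (- q) ^ w\<close> is
  \<open>1 + q ^ w\<close>. With \<open>\<zeta> = \<xi> ^ c\<close> and scale \<open>c\<close> it
  depends only on \<open>\<xi>\<close>, \<open>d\<close> and the product \<open>c * w\<close>, hence
  agrees for all three indices.\<close>

lemma alt_exp_sum_mult_odd: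
  fixes chi :: "int \<Rightarrow> 'a::field_char_0"
  assumes "\<And>a. chi (a + int d) = chi a" and "odd d" and "odd w"
  shows "(fps_const (\<zeta> ^ d) * fps_exp (of_nat d * c) + 1) * alt_exp_sum (w * d) chi \<zeta> c =
    alt_exp_sum d chi \<zeta> c * (1 + fps_const (\<zeta> ^ (d * w)) * fps_exp (of_nat (w * d) * c))"
  using alt_exp_sum_mult[of chi d \<zeta> c w, OF assms(1,2)] \<open>odd w\<close>
  by (simp add: power_mult_distrib fps_const_power fps_exp_power_mult mult_ac flip: power_mult)

text \<open>This is the defining generating function with \<open>c t\<close> put for
  \<open>t\<close> and the denominator cleared. Clearing is legitimate because the constant term
  \<open>\<zeta> ^ d + 1\<close> is nonzero.\<close>

lemma twisted_euler_poly_egf: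
  fixes \<zeta> :: "'a::field_char_0"
  assumes "d > 0" and "\<zeta> ^ d \<noteq> -1"
  shows "(fps_const (\<zeta> ^ d) * fps_exp (of_nat d * c) + 1) *
      Abs_fps (\<lambda>k. c ^ k * poly (twisted_euler_poly d k chi \<zeta>) x / fact k) =
    2 * fps_exp (c * x) * alt_exp_sum d chi \<zeta> c"
proof -
  let ?D = "fps_const (\<zeta> ^ d) * fps_exp (of_nat d) + 1"
  let ?G = "Abs_fps (\<lambda>n. poly (twisted_euler_poly d n chi \<zeta>) x / fact n)"
  let ?cX = "fps_const c * fps_X"
  have D0: "?D $ 0 \<noteq> 0"
    using assms(2) by (simp add: add_eq_0_iff2)
  have G: "fps_compose ?G ?cX =
      Abs_fps (\<lambda>k. c ^ k * poly (twisted_euler_poly d k chi \<zeta>) x / fact k)"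
    by (simp add: fps_compose_linear)
  have exp: "fps_compose (fps_exp b) ?cX = fps_exp (c * b)" for b
    by (simp add: fps_compose_linear fps_eq_iff power_mult_distrib)
  have cancel: "?D * (2 / ?D) = 2"
    unfolding fps_divide_unit[OF D0] mult.left_commute[of _ 2] inverse_mult_eq_1'[OF D0] by simp
  have "{0..d - 1} = {..<d}" using \<open>d > 0\<close> by auto
  then have "?D * twisted_euler_gf d chi \<zeta> = 2 * alt_exp_sum d chi \<zeta> 1"
    unfolding twisted_euler_gf_def alt_exp_sum_def mult.assoc[symmetric] cancel by simp
  then have "?D * ?G = 2 * fps_exp x * alt_exp_sum d chi \<zeta> 1"
    by (simp add: twisted_euler_poly_generating_function mult.left_commute)
  then have "fps_compose (?D * ?G) ?cX = fps_compose (2 * fps_exp x * alt_exp_sum d chi \<zeta> 1) ?cX"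
    by simp
  moreover have "fps_compose 2 ?cX = (2 :: 'a fps)"
    by (metis fps_const_compose numeral_fps_const)
  ultimately show ?thesis
    by (simp add: fps_compose_mult_distrib fps_compose_add_distrib fps_compose_sum_distrib
        alt_exp_sum_def G exp) (simp add: mult_ac)
qed

text \<open>A product of exponential generating functions has trinomial convolutions as
  coefficients: expand two Cauchy products, with outer index \<open>i = k + l\<close>.\<close>

lemma sum_trinomial_egf:
  fixes f g h :: "nat \<Rightarrow> 'a::field_char_0"
  shows "(\<Sum>(k, l, m) \<in> {(k, l, m). k + l + m = n}. trinomial n k l m * f k * g l * h m) =
    fact n * (Abs_fps (\<lambda>k. f k / fact k) * Abs_fps (\<lambda>l. g l / fact l) *
      Abs_fps (\<lambda>m. h m / fact m)) $ n"
proof -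
  have "(Abs_fps (\<lambda>k. f k / fact k) * Abs_fps (\<lambda>l. g l / fact l) *
      Abs_fps (\<lambda>m. h m / fact m)) $ n =
    (\<Sum>i=0..n. \<Sum>k=0..i. f k / fact k * (g (i - k) / fact (i - k)) * (h (n - i) / fact (n - i)))"
    by (simp add: fps_mult_nth sum_distrib_right sum_divide_distrib)
  also have "\<dots> = (\<Sum>(i, k) \<in> (SIGMA i:{0..n}. {0..i}).
      f k / fact k * (g (i - k) / fact (i - k)) * (h (n - i) / fact (n - i)))"
    by (simp add: sum.Sigma)
  also have "\<dots> = (\<Sum>(k, l, m) \<in> {(k, l, m). k + l + m = n}.
      f k / fact k * (g l / fact l) * (h m / fact m))"
    by (rule sum.reindex_bij_witness[where i = "\<lambda>(k, l, m). (k + l, k)"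
          and j = "\<lambda>(i, k). (k, i - k, n - i)"]) auto
  finally show ?thesis
    by (simp add: sum_distrib_left trinomial_def case_prod_beta mult_ac)
qed

text \<open>One step of the cycle \<open>w1\<close>, \<open>w2\<close>, \<open>w3\<close> is enough:
  the second equality of the theorem is the same statement for shifted weights.\<close>

lemma twisted_euler_power_sum_cyclic:
  fixes \<xi> y :: "'a::field_char_0" and chi :: "int \<Rightarrow> 'a"
  assumes per: "\<And>a. chi (a + int d) = chi a" and "odd d"
    and ne: "\<And>j. \<xi> ^ j \<noteq> -1"
    and odd: "odd w1" "odd w2" "odd w3"
  shows "(\<Sum>(k, l, m) \<in> {(k, l, m). k + l + m = n}. trinomial n k l m *
        poly (twisted_euler_poly d k chi (\<xi> ^ (w2 * w3))) (of_nat w1 * y) *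
        alt_power_sum l (w2 * d - 1) chi (\<xi> ^ (w1 * w3)) *
        alt_power_sum m (w3 * d - 1) chi (\<xi> ^ (w1 * w2)) *
        of_nat w1 ^ (l + m) * of_nat w2 ^ (k + m) * of_nat w3 ^ (k + l))
     = (\<Sum>(k, l, m) \<in> {(k, l, m). k + l + m = n}. trinomial n k l m *
        poly (twisted_euler_poly d k chi (\<xi> ^ (w1 * w3))) (of_nat w2 * y) *
        alt_power_sum l (w3 * d - 1) chi (\<xi> ^ (w1 * w2)) *
        alt_power_sum m (w1 * d - 1) chi (\<xi> ^ (w2 * w3)) *
        of_nat w2 ^ (l + m) * of_nat w3 ^ (k + m) * of_nat w1 ^ (k + l))"
proof -
  define E where "E v c = Abs_fps (\<lambda>k. of_nat c ^ k *
    poly (twisted_euler_poly d k chi (\<xi> ^ c)) (of_nat v * y) / fact k)" for v c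
  define T where "T v c = alt_exp_sum (v * d) chi (\<xi> ^ c) (of_nat c)" for v c
  define S where "S c = alt_exp_sum d chi (\<xi> ^ c) (of_nat c)" for c
  define D where "D c = fps_const ((\<xi> ^ c) ^ d) * fps_exp (of_nat d * of_nat c) + 1" for c
  define w where "w = w1 * w2 * w3"
  define A where "A = fps_const (\<xi> ^ (w * d)) * fps_exp (of_nat (w * d))"
  have "d > 0" using \<open>odd d\<close> by (rule odd_pos)
  have D: "D c \<noteq> 0" for c
  proof
    assume "D c = 0"
    then have "D c $ 0 = 0" by simp
    with ne[of "c * d"] show False by (simp add: D_def power_mult add_eq_0_iff2)
  qed
  \<comment> \<open>The condition \<open>c * v = w\<close> turns the exponent \<open>c v y\<close>
    into \<open>w y\<close>, the same for every index.\<close>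
  have E: "D c * E v c = 2 * fps_exp (of_nat w * y) * S c" if "c * v = w" for c v
    using twisted_euler_poly_egf[of d "\<xi> ^ c" "of_nat c" chi "of_nat v * y"] ne[of "c * d"] \<open>d > 0\<close>
    by (simp add: E_def D_def S_def power_mult mult.assoc flip: that)
  have T: "D c * T v c = S c * (1 + A)" if "c * v = w" "odd v" for c v
    using alt_exp_sum_mult_odd[of chi d v "\<xi> ^ c" "of_nat c", OF per \<open>odd d\<close> \<open>odd v\<close>]
    by (simp add: T_def D_def S_def A_def mult_ac flip: that(1) power_mult)
  \<comment> \<open>The weights regroup as \<open>b1 ^ k * b2 ^ l * b3 ^ m\<close>, exactly the
    scalings built into \<open>E\<close> and \<open>T\<close>.\<close>
  have sum: "(\<Sum>(k, l, m) \<in> {(k, l, m). k + l + m = n}. trinomial n k l m *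
        poly (twisted_euler_poly d k chi (\<xi> ^ b1)) (of_nat v1 * y) *
        alt_power_sum l (v2 * d - 1) chi (\<xi> ^ b2) *
        alt_power_sum m (v3 * d - 1) chi (\<xi> ^ b3) *
        of_nat v1 ^ (l + m) * of_nat v2 ^ (k + m) * of_nat v3 ^ (k + l)) =
      fact n * (E v1 b1 * T v2 b2 * T v3 b3) $ n"
    if "b1 = v2 * v3" "b2 = v1 * v3" "b3 = v1 * v2" "odd v2" "odd v3" for v1 v2 v3 b1 b2 b3
  proof -
    have pos: "v2 * d > 0" "v3 * d > 0"
      using that \<open>d > 0\<close> by (auto intro: odd_pos)
    show ?thesis
      unfolding E_def T_def alt_power_sum_egf[OF pos(1), symmetric]
        alt_power_sum_egf[OF pos(2), symmetric] sum_trinomial_egf[symmetric]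
      by (rule sum.cong) (auto simp: that(1-3) power_add power_mult_distrib mult_ac)
  qed
  define c1 c2 c3 where "c1 = w2 * w3" and "c2 = w1 * w3" and "c3 = w1 * w2"
  have c: "c1 * w1 = w" "c2 * w2 = w" "c3 * w3 = w"
    by (simp_all add: c1_def c2_def c3_def w_def mult_ac)
  \<comment> \<open>Multiplied by all three denominators, both products become
    \<open>2 exp (w y t) S\<^sub>1 S\<^sub>2 S\<^sub>3 (1 + A)\<^sup>2\<close>; nonzero factors then
    cancel in the integral domain of power series.\<close>
  have "(D c1 * D c2 * D c3) * (E w1 c1 * T w2 c2 * T w3 c3) =
      (D c1 * E w1 c1) * (D c2 * T w2 c2) * (D c3 * T w3 c3)"
    by (simp only: mult_ac)
  also have "\<dots> = (D c2 * E w2 c2) * (D c3 * T w3 c3) * (D c1 * T w1 c1)"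
    unfolding E[OF c(1)] E[OF c(2)] T[OF c(1) odd(1)] T[OF c(2) odd(2)] T[OF c(3) odd(3)]
    by (simp only: mult_ac)
  also have "\<dots> = (D c1 * D c2 * D c3) * (E w2 c2 * T w3 c3 * T w1 c1)"
    by (simp only: mult_ac)
  finally have eq: "E w1 c1 * T w2 c2 * T w3 c3 = E w2 c2 * T w3 c3 * T w1 c1"
    using D by simp
  show ?thesis
    unfolding sum[OF refl refl refl odd(2,3)] sum[OF mult.commute mult.commute refl odd(3,1)]
      eq[unfolded c1_def c2_def c3_def] ..
qed

theorem theorem4:
  fixes p d w1 w2 w3 n :: nat
    and \<xi> y1 :: "'a::{field_char_0, complete_space}"
    and \<sigma> :: "complex \<Rightarrow> 'a"
    and chi\<^sub>0 :: "int \<Rightarrow> complex"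
    and chi :: "int \<Rightarrow> 'a"
  assumes "prime p" and "odd p"
    and "is_Cp p TYPE('a)"
    and "\<exists>s>0. \<xi> ^ (p ^ s) = 1"
    and "odd d" and "d > 0"
    and "embedding_of_algebraic_numbers \<sigma>"
    and "primitive_character d chi\<^sub>0"
    and "chi = (\<lambda>a. \<sigma> (chi\<^sub>0 a))"
    and "odd w1" and "w1 > 0" and "odd w2" and "w2 > 0" and "odd w3" and "w3 > 0"
    and "y1 \<in> Zp"
  shows
    "(\<Sum>(k, l, m) \<in> {(k, l, m). k + l + m = n}. trinomial n k l m *
        poly (twisted_euler_poly d k chi (\<xi> ^ (w2 * w3))) (of_nat w1 * y1) *
        alt_power_sum l (w2 * d - 1) chi (\<xi> ^ (w1 * w3)) *
        alt_power_sum m (w3 * d - 1) chi (\<xi> ^ (w1 * w2)) *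
        of_nat w1 ^ (l + m) * of_nat w2 ^ (k + m) * of_nat w3 ^ (k + l))
     = (\<Sum>(k, l, m) \<in> {(k, l, m). k + l + m = n}. trinomial n k l m *
        poly (twisted_euler_poly d k chi (\<xi> ^ (w1 * w3))) (of_nat w2 * y1) *
        alt_power_sum l (w3 * d - 1) chi (\<xi> ^ (w1 * w2)) *
        alt_power_sum m (w1 * d - 1) chi (\<xi> ^ (w2 * w3)) *
        of_nat w2 ^ (l + m) * of_nat w3 ^ (k + m) * of_nat w1 ^ (k + l))
   \<and> (\<Sum>(k, l, m) \<in> {(k, l, m). k + l + m = n}. trinomial n k l m *
        poly (twisted_euler_poly d k chi (\<xi> ^ (w1 * w3))) (of_nat w2 * y1) *
        alt_power_sum l (w3 * d - 1) chi (\<xi> ^ (w1 * w2)) *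
        alt_power_sum m (w1 * d - 1) chi (\<xi> ^ (w2 * w3)) *
        of_nat w2 ^ (l + m) * of_nat w3 ^ (k + m) * of_nat w1 ^ (k + l))
     = (\<Sum>(k, l, m) \<in> {(k, l, m). k + l + m = n}. trinomial n k l m *
        poly (twisted_euler_poly d k chi (\<xi> ^ (w1 * w2))) (of_nat w3 * y1) *
        alt_power_sum l (w1 * d - 1) chi (\<xi> ^ (w2 * w3)) *
        alt_power_sum m (w2 * d - 1) chi (\<xi> ^ (w1 * w3)) *
        of_nat w3 ^ (l + m) * of_nat w1 ^ (k + m) * of_nat w2 ^ (k + l))"
proof -
  have per: "chi (a + int d) = chi a" for a
    using assms(8,9) by (simp add: primitive_character_def dirichlet_character_def)
  obtain s where s: "\<xi> ^ (p ^ s) = 1" using assms(4) by blast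
  \<comment> \<open>Raising \<open>\<xi> ^ j = -1\<close> to the odd power \<open>p ^ s\<close>
    would give \<open>1 = -1\<close>, impossible in characteristic zero.\<close>
  have ne: "\<xi> ^ j \<noteq> -1" for j
  proof
    assume "\<xi> ^ j = -1"
    then have "(-1 :: 'a) ^ (p ^ s) = (\<xi> ^ (p ^ s)) ^ j"
      by (metis power_mult mult.commute)
    then show False using s \<open>odd p\<close> by simp
  qed
  note cyclic = twisted_euler_power_sum_cyclic[of chi d \<xi>, OF per \<open>odd d\<close> ne]
  \<comment> \<open>The second instance runs through \<open>w2\<close>, \<open>w3\<close>,
    \<open>w1\<close>; commuting the products restores the exponents \<open>w1 * w3\<close> and
    \<open>w1 * w2\<close>.\<close>
  show ?thesis
    using cyclic[OF assms(10,12,14)]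
      cyclic[OF assms(12,14,10), unfolded mult.commute[of w3 w1] mult.commute[of w2 w1]]
    by (rule conjI)
qed

end
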